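(* Let $(X,d_\phi)$ be a complete $\phi$-metric space, let $k\in(0,1)$, and let $T:X\to X$ be a mapping satisfying $d_\phi(Tx,Ty)\le k\,d_\phi(x,y)$ for all $x,y\in X$. Then $T$ has a unique fixed point in $X$.
   Context: Definition ($\phi$-metric space). Let $X$ be a nonempty set. A function $d_\phi:X\times X\to\mathbb{R}_{\ge 0}$ is a $\phi$-metric, and $(X,d_\phi)$ is a $\phi$-metric space, if there is a function $\phi:X\times X\times X\to\mathbb{R}_{\ge 0}$ such that for all $x,y,z\in X$: (d1) $d_\phi(x,y)=0$ if and only if $x=y$; (d2) $d_\phi(x,y)=d_\phi(y,x)$; (d3) $d_\phi(x,y)\le d_\phi(x,z)+d_\phi(z,y)+\phi(x,y,z)$; where $\phi$ satisfies: ($\phi1$) $\phi(x,y,z)=0$ if $x=z$ or $y=z$; ($\phi2$) $\phi(x,y,z)=\phi(y,x,z)$; ($\phi3$) for every $\epsilon>0$ there exists $\delta>0$ such that for all $x,y,z\in X$, $\phi(x,y,z)<\epsilon$ whenever $d_\phi(x,z)<\delta$ or $d_\phi(y,z)<\delta$. A sequence $\{x_n\}$ in $X$ converges to $x\in X$ if $d_\phi(x_n,x)\to 0$ as $n\to\infty$; it is Cauchy if for every $\epsilon>0$ there is $N$ with $d_\phi(x_n,x_m)<\epsilon$ for all $m,n\ge N$. $(X,d_\phi)$ is complete if every Cauchy sequence in $X$ converges to some point of $X$. *)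

theory Defs
  imports Complex_Main
begin

definition control_fun_on :: "'a set \<Rightarrow> ('a \<Rightarrow> 'a \<Rightarrow> real) \<Rightarrow> ('a \<Rightarrow> 'a \<Rightarrow> 'a \<Rightarrow> real) \<Rightarrow> bool" where
  "control_fun_on X d \<phi> \<longleftrightarrow>
     (\<forall>x\<in>X. \<forall>y\<in>X. \<forall>z\<in>X. \<phi> x y z \<ge> 0) \<and>
     (\<forall>x\<in>X. \<forall>y\<in>X. \<forall>z\<in>X. x = z \<or> y = z \<longrightarrow> \<phi> x y z = 0) \<and>
     (\<forall>x\<in>X. \<forall>y\<in>X. \<forall>z\<in>X. \<phi> x y z = \<phi> y x z) \<and>
     (\<forall>\<epsilon>>0. \<exists>\<delta>>0. \<forall>x\<in>X. \<forall>y\<in>X. \<forall>z\<in>X. d x z < \<delta> \<or> d y z < \<delta> \<longrightarrow> \<phi> x y z < \<epsilon>)"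

text \<open>The function \<open>\<phi>\<close> is not part of the structure: a \<open>\<phi>\<close>-metric is a function \<open>d\<close> for
  which some such \<open>\<phi>\<close> exists. Values of \<open>d\<close> and \<open>\<phi>\<close> outside the carrier \<open>X\<close> are irrelevant.\<close>

definition phi_metric_space :: "'a set \<Rightarrow> ('a \<Rightarrow> 'a \<Rightarrow> real) \<Rightarrow> bool" where
  "phi_metric_space X d \<longleftrightarrow>
     X \<noteq> {} \<and>
     (\<forall>x\<in>X. \<forall>y\<in>X. d x y \<ge> 0) \<and>
     (\<exists>\<phi>. control_fun_on X d \<phi> \<and>
       (\<forall>x\<in>X. \<forall>y\<in>X. d x y = 0 \<longleftrightarrow> x = y) \<and>
       (\<forall>x\<in>X. \<forall>y\<in>X. d x y = d y x) \<and>
       (\<forall>x\<in>X. \<forall>y\<in>X. \<forall>z\<in>X. d x y \<le> d x z + d z y + \<phi> x y z))"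

definition phi_converges :: "('a \<Rightarrow> 'a \<Rightarrow> real) \<Rightarrow> (nat \<Rightarrow> 'a) \<Rightarrow> 'a \<Rightarrow> bool" where
  "phi_converges d s x \<longleftrightarrow> (\<lambda>n. d (s n) x) \<longlonglongrightarrow> 0"

definition phi_Cauchy :: "('a \<Rightarrow> 'a \<Rightarrow> real) \<Rightarrow> (nat \<Rightarrow> 'a) \<Rightarrow> bool" where
  "phi_Cauchy d s \<longleftrightarrow> (\<forall>\<epsilon>>0. \<exists>N. \<forall>m\<ge>N. \<forall>n\<ge>N. d (s n) (s m) < \<epsilon>)"

definition phi_complete :: "'a set \<Rightarrow> ('a \<Rightarrow> 'a \<Rightarrow> real) \<Rightarrow> bool" where
  "phi_complete X d \<longleftrightarrow>
     (\<forall>s :: nat \<Rightarrow> 'a. range s \<subseteq> X \<and> phi_Cauchy d s \<longrightarrow> (\<exists>x\<in>X. phi_converges d s x))"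

end

theory Submission
  imports Defs
begin

text \<open>The control function is uniformly small once one of the two legs of the triangle is short,
  so \<open>d x y < d z y + \<epsilon>\<close> whenever \<open>d x z\<close> is below a threshold depending only on \<open>\<epsilon>\<close>. Hence, if
  \<open>d (T z) z\<close> is small compared with \<open>(1 - k) \<epsilon>\<close>, the \<open>\<epsilon>\<close>-ball around \<open>z\<close> is mapped into itself.
  Since consecutive Picard iterates get arbitrarily close, the orbit is eventually trapped in
  arbitrarily small balls. Trapping replaces the usual summation of a geometric series, which
  is of no use here because the errors \<open>\<phi>\<close> need not be summable.\<close>

lemma phi_metric_space_uniform_triangle:
  assumes "phi_metric_space X d" and "\<epsilon> > 0"
  obtains \<delta> where "\<delta> > 0"
    and "\<And>x y z. x \<in> X \<Longrightarrow> y \<in> X \<Longrightarrow> z \<in> X \<Longrightarrow> d x z < \<delta> \<Longrightarrow> d x y < d z y + \<epsilon>"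
proof -
  obtain \<phi> where \<phi>: "control_fun_on X d \<phi>"
    and tri: "\<And>x y z. x \<in> X \<Longrightarrow> y \<in> X \<Longrightarrow> z \<in> X \<Longrightarrow> d x y \<le> d x z + d z y + \<phi> x y z"
    using assms(1) unfolding phi_metric_space_def by blast
  have "\<epsilon> / 2 > 0" using assms(2) by simp
  with \<phi> obtain \<delta> where "\<delta> > 0"
    and small: "\<And>x y z. x \<in> X \<Longrightarrow> y \<in> X \<Longrightarrow> z \<in> X \<Longrightarrow> d x z < \<delta> \<Longrightarrow> \<phi> x y z < \<epsilon> / 2"
    unfolding control_fun_on_def by meson
  show thesis
  \<comment> \<open>One half of \<open>\<epsilon>\<close> pays for the short leg
    \<open>d x z\<close> itself, the other half for the error \<open>\<phi> x y z\<close>.\<close>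
  proof (rule that[of "min \<delta> (\<epsilon> / 2)"])
    show "min \<delta> (\<epsilon> / 2) > 0" using \<open>\<delta> > 0\<close> \<open>\<epsilon> / 2 > 0\<close> by simp
  next
    fix x y z assume "x \<in> X" "y \<in> X" "z \<in> X" "d x z < min \<delta> (\<epsilon> / 2)"
    then show "d x y < d z y + \<epsilon>"
      using tri[of x y z] small[of x y z] by fastforce
  qed
qed

lemma phi_metric_space_nonneg:
  "phi_metric_space X d \<Longrightarrow> x \<in> X \<Longrightarrow> y \<in> X \<Longrightarrow> 0 \<le> d x y"
  unfolding phi_metric_space_def by blast

lemma phi_metric_space_commute:
  "phi_metric_space X d \<Longrightarrow> x \<in> X \<Longrightarrow> y \<in> X \<Longrightarrow> d x y = d y x"
  unfolding phi_metric_space_def by blast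

lemma phi_metric_space_zero_iff:
  "phi_metric_space X d \<Longrightarrow> x \<in> X \<Longrightarrow> y \<in> X \<Longrightarrow> d x y = 0 \<longleftrightarrow> x = y"
  unfolding phi_metric_space_def by blast

text \<open>Going from \<open>x\<close> to \<open>y\<close> through a late term \<open>s n\<close>,
  both legs are short, and so is the triangle error because the leg \<open>d x (s n)\<close> is;
  thus \<open>d x y\<close> lies below every positive \<open>e\<close>. This will identify
  \<open>T x\<close> with \<open>x\<close>.\<close>

lemma phi_converges_unique:
  assumes X: "phi_metric_space X d" and s: "range s \<subseteq> X" and "x \<in> X" "y \<in> X"
    and sx: "phi_converges d s x" and sy: "phi_converges d s y"
  shows "x = y"
proof -
  have "d x y \<le> 0 + e" if "e > 0" for e
  proof -
    have "e / 2 > 0" using that by simp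
    from phi_metric_space_uniform_triangle[OF X this] obtain \<delta> where "\<delta> > 0"
      and \<delta>: "\<And>x y z. x \<in> X \<Longrightarrow> y \<in> X \<Longrightarrow> z \<in> X \<Longrightarrow> d x z < \<delta> \<Longrightarrow> d x y < d z y + e / 2"
      by metis
    have "\<forall>\<^sub>F n in sequentially. d (s n) x < \<delta> \<and> d (s n) y < e / 2"
      using order_tendstoD(2)[OF sx[unfolded phi_converges_def] \<open>\<delta> > 0\<close>]
        order_tendstoD(2)[OF sy[unfolded phi_converges_def] \<open>e / 2 > 0\<close>]
      by (rule eventually_conj)
    then obtain n where "d (s n) x < \<delta>" "d (s n) y < e / 2"
      by (auto simp: eventually_sequentially)
    moreover have "s n \<in> X" using s by blast
    ultimately show ?thesis
      using \<delta>[of x y "s n"] \<open>x \<in> X\<close> \<open>y \<in> X\<close> phi_metric_space_commute[OF X, of x "s n"] by simp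
  qed
  then have "d x y \<le> 0" by (rule field_le_epsilon)
  then show ?thesis
    using phi_metric_space_nonneg[OF X, of x y] phi_metric_space_zero_iff[OF X, of x y]
      \<open>x \<in> X\<close> \<open>y \<in> X\<close> by simp
qed

text \<open>Trapping controls only distances to the centre \<open>s N\<close> of a ball. Two points
  of the tail are compared through that centre, with a radius chosen so small that the triangle
  error is also under control.\<close>

lemma phi_CauchyI_tail:
  assumes X: "phi_metric_space X d" and s: "range s \<subseteq> X"
    and tail: "\<And>\<epsilon>. \<epsilon> > 0 \<Longrightarrow> \<exists>N. \<forall>n\<ge>N. d (s n) (s N) < \<epsilon>"
  shows "phi_Cauchy d s"
  unfolding phi_Cauchy_def
proof (intro allI impI)
  fix \<epsilon> :: real assume "\<epsilon> > 0"
  then have "\<epsilon> / 2 > 0" by simp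
  from phi_metric_space_uniform_triangle[OF X this] obtain \<delta> where "\<delta> > 0"
    and \<delta>: "\<And>x y z. x \<in> X \<Longrightarrow> y \<in> X \<Longrightarrow> z \<in> X \<Longrightarrow> d x z < \<delta> \<Longrightarrow> d x y < d z y + \<epsilon> / 2"
    by metis
  \<comment> \<open>\<open>\<delta>\<close> makes the leg from \<open>s n\<close> to the centre cost
    at most \<open>\<epsilon> / 2\<close>, error included; \<open>\<epsilon> / 2\<close> bounds the
    leg from the centre to \<open>s m\<close>.\<close>
  have "min \<delta> (\<epsilon> / 2) > 0" using \<open>\<delta> > 0\<close> \<open>\<epsilon> / 2 > 0\<close> by simp
  from tail[OF this] obtain N where N: "\<And>n. n \<ge> N \<Longrightarrow> d (s n) (s N) < min \<delta> (\<epsilon> / 2)"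
    by blast
  have "d (s n) (s m) < \<epsilon>" if "m \<ge> N" "n \<ge> N" for m n
  proof -
    have mem: "s i \<in> X" for i using s by blast
    have "d (s n) (s m) < d (s N) (s m) + \<epsilon> / 2"
      using \<delta>[OF mem mem mem] N[OF \<open>n \<ge> N\<close>] by simp
    also have "d (s N) (s m) < \<epsilon> / 2"
      using N[OF \<open>m \<ge> N\<close>] phi_metric_space_commute[OF X mem mem, of N m] by simp
    finally show ?thesis by simp
  qed
  then show "\<exists>N. \<forall>m\<ge>N. \<forall>n\<ge>N. d (s n) (s m) < \<epsilon>" by blast
qed

lemma phi_contraction_iterates_Cauchy:
  assumes X: "phi_metric_space X d" and "0 \<le> k" "k < 1"
    and T: "\<And>x. x \<in> X \<Longrightarrow> T x \<in> X"
    and contr: "\<And>x y. x \<in> X \<Longrightarrow> y \<in> X \<Longrightarrow> d (T x) (T y) \<le> k * d x y"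
    and "x0 \<in> X"
  shows "phi_Cauchy d (\<lambda>n. (T ^^ n) x0)"
proof -
  define s where "s = (\<lambda>n. (T ^^ n) x0)"
  have s_Suc: "s (Suc n) = T (s n)" for n by (simp add: s_def)
  have mem: "s n \<in> X" for n
    by (induction n) (use \<open>x0 \<in> X\<close> T in \<open>auto simp: s_def\<close>)
  \<comment> \<open>The geometric decay is never summed: it serves only to find a single
    \<open>N\<close> at which the orbit moves by less than \<open>\<delta>\<close>.\<close>
  have step: "d (s (Suc n)) (s n) \<le> k ^ n * d (s 1) (s 0)" for n
  proof (induction n)
    case 0
    then show ?case by simp
  next
    case (Suc n)
    have "d (s (Suc (Suc n))) (s (Suc n)) \<le> k * d (s (Suc n)) (s n)"
      using contr[OF mem mem, of "Suc n" n] by (simp add: s_Suc)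
    also have "\<dots> \<le> k * (k ^ n * d (s 1) (s 0))"
      using Suc \<open>0 \<le> k\<close> by (rule mult_left_mono)
    finally show ?case by simp
  qed
  have bound_lim: "(\<lambda>n. k ^ n * d (s 1) (s 0)) \<longlonglongrightarrow> 0"
    using tendsto_mult_left_zero[OF LIMSEQ_realpow_zero[OF \<open>0 \<le> k\<close> \<open>k < 1\<close>]] .
  have "\<exists>N. \<forall>n\<ge>N. d (s n) (s N) < \<epsilon>" if "\<epsilon> > 0" for \<epsilon>
  proof -
    \<comment> \<open>This slack is what the contraction leaves free:
      \<open>k * \<epsilon> + (1 - k) * \<epsilon> = \<epsilon>\<close>.\<close>
    have "(1 - k) * \<epsilon> > 0" using that \<open>k < 1\<close> by simp
    from phi_metric_space_uniform_triangle[OF X this] obtain \<delta> where "\<delta> > 0"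
      and \<delta>: "\<And>x y z. x \<in> X \<Longrightarrow> y \<in> X \<Longrightarrow> z \<in> X \<Longrightarrow> d x z < \<delta> \<Longrightarrow> d x y < d z y + (1 - k) * \<epsilon>"
      by metis
    obtain N where "k ^ N * d (s 1) (s 0) < \<delta>"
      using order_tendstoD(2)[OF bound_lim \<open>\<delta> > 0\<close>] by (auto simp: eventually_sequentially)
    then have N: "d (s (Suc N)) (s N) < \<delta>" using step[of N] by simp
    have "d (s n) (s N) < \<epsilon>" if "n \<ge> N" for n
      using that
    proof (induction n rule: dec_induct)
      case base
      then show ?case using \<open>\<epsilon> > 0\<close> phi_metric_space_zero_iff[OF X mem mem, of N N] by simp
    next
      case (step n)
      \<comment> \<open>The detour goes through \<open>s (Suc N)\<close>, the image of the centre,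
        so that the remaining leg joins two images under \<open>T\<close> and contracts to at most
        \<open>k * \<epsilon>\<close> by the induction hypothesis.\<close>
      have "d (s N) (s (Suc n)) < d (s (Suc N)) (s (Suc n)) + (1 - k) * \<epsilon>"
        using \<delta>[OF mem mem mem] N phi_metric_space_commute[OF X mem mem, of "Suc N" N] by simp
      also have "d (s (Suc N)) (s (Suc n)) \<le> k * d (s N) (s n)"
        using contr[OF mem mem, of N n] by (simp add: s_Suc)
      also have "k * d (s N) (s n) \<le> k * \<epsilon>"
        using step.IH \<open>0 \<le> k\<close> phi_metric_space_commute[OF X mem mem, of N n]
        by (intro mult_left_mono) auto
      finally show ?case
        using phi_metric_space_commute[OF X mem mem, of N "Suc n"] by (simp add: algebra_simps)
    qed
    then show ?thesis by blast
  qed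
  then have "phi_Cauchy d s"
    by (intro phi_CauchyI_tail[OF X]) (use mem in auto)
  then show ?thesis by (simp add: s_def)
qed

theorem theorem5p2:
  fixes X :: "'a set" and d :: "'a \<Rightarrow> 'a \<Rightarrow> real" and k :: real and T :: "'a \<Rightarrow> 'a"
  assumes "phi_metric_space X d"
    and "phi_complete X d"
    and "0 < k" and "k < 1"
    and "\<And>x. x \<in> X \<Longrightarrow> T x \<in> X"
    and "\<And>x y. x \<in> X \<Longrightarrow> y \<in> X \<Longrightarrow> d (T x) (T y) \<le> k * d x y"
  shows "\<exists>!x. x \<in> X \<and> T x = x"
proof -
  note X = assms(1) and T = assms(5) and contr = assms(6)
  obtain x0 where "x0 \<in> X" using X unfolding phi_metric_space_def by blast
  define s where "s = (\<lambda>n. (T ^^ n) x0)"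
  have mem: "s n \<in> X" for n
    by (induction n) (use \<open>x0 \<in> X\<close> T in \<open>auto simp: s_def\<close>)
  have "phi_Cauchy d s"
    unfolding s_def using phi_contraction_iterates_Cauchy[OF X _ assms(4) T contr \<open>x0 \<in> X\<close>] \<open>0 < k\<close>
    by simp
  then obtain x where "x \<in> X" and sx: "phi_converges d s x"
    using assms(2) mem unfolding phi_complete_def by blast
  \<comment> \<open>The shifted orbit converges to \<open>x\<close> as a tail of \<open>s\<close>,
    and to \<open>T x\<close> because its terms are the images of the \<open>s n\<close> and
    \<open>T\<close> contracts; limits are unique.\<close>
  have "phi_converges d (\<lambda>n. s (Suc n)) x"
    using LIMSEQ_Suc[OF sx[unfolded phi_converges_def]] by (simp add: phi_converges_def)
  moreover have "phi_converges d (\<lambda>n. s (Suc n)) (T x)"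
    unfolding phi_converges_def
  proof (rule tendsto_sandwich)
    show "\<forall>\<^sub>F n in sequentially. 0 \<le> d (s (Suc n)) (T x)"
      using phi_metric_space_nonneg[OF X mem T[OF \<open>x \<in> X\<close>]] by simp
    show "\<forall>\<^sub>F n in sequentially. d (s (Suc n)) (T x) \<le> k * d (s n) x"
      using contr[OF mem \<open>x \<in> X\<close>] by (simp add: s_def)
    show "(\<lambda>n. k * d (s n) x) \<longlonglongrightarrow> 0"
      using sx unfolding phi_converges_def by (rule tendsto_mult_right_zero)
  qed simp
  ultimately have "T x = x"
    using phi_converges_unique[OF X, of "\<lambda>n. s (Suc n)" "T x" x] mem T \<open>x \<in> X\<close> by blast
  moreover have "y = x" if "y \<in> X" "T y = y" for y
  proof -
    \<comment> \<open>Both points are fixed, so the contraction reads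
      \<open>d y x \<le> k * d y x\<close>.\<close>
    have "(1 - k) * d y x \<le> 0"
      using contr[OF \<open>y \<in> X\<close> \<open>x \<in> X\<close>] \<open>T x = x\<close> \<open>T y = y\<close> by (simp add: algebra_simps)
    then have "d y x \<le> 0" using \<open>k < 1\<close> by (simp add: mult_le_0_iff)
    then show ?thesis
      using phi_metric_space_nonneg[OF X \<open>y \<in> X\<close> \<open>x \<in> X\<close>]
        phi_metric_space_zero_iff[OF X \<open>y \<in> X\<close> \<open>x \<in> X\<close>] by simp
  qed
  ultimately show ?thesis using \<open>x \<in> X\<close> by blast
qed

end
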